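(* Let $G$ be a finite group with identity $e$, and let $\mathcal{H}_A,\mathcal{H}_B$ be finite-dimensional complex Hilbert spaces. Let $\{U(f):f\in G\}$ be a projective unitary representation of $G$ on $\mathcal{H}_A$ with factor system $\mu(f,g)$ and $U(e)=I_A$. Let $\{W(f):f\in G\}$ be operators on $\mathcal{H}_B$ such that the operator $$M=\sum_{f\in G}R(f)\otimes W(f),\qquad R(f)=\sum_{g\in G}\mu(g,f)\,|g\rangle\langle gf|,$$ on $\mathcal{H}_b\otimes\mathcal{H}_B$ is unitary, where $\mathcal{H}_b$ has orthonormal basis $\{|g\rangle:g\in G\}$. Then $\mathcal{U}=\sum_{f\in G}U(f)\otimes W(f)$ is a unitary operator on $\mathcal{H}_A\otimes\mathcal{H}_B$, and the group protocol described in the context deterministically implements $\mathcal{U}$ on $\mathcal{H}_A\otimes\mathcal{H}_B$.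
   Context: A projective unitary representation of $G$ with factor system $\mu$ is a family of unitary operators $U(f)$, $f\in G$, with $U(f)U(g)=\mu(f,g)U(fg)$ for all $f,g\in G$, where the $\mu(f,g)$ are complex numbers of magnitude 1. Group protocol. Ancillary systems $a,b$ have Hilbert spaces $\mathcal{H}_a,\mathcal{H}_b$ each with orthonormal (standard) basis $\{|f\rangle:f\in G\}$. Fix a unitary $F$ on $\mathcal{H}_a$ all of whose matrix elements $\langle h|F|f\rangle$ in the standard basis have magnitude $|G|^{-1/2}$, and a complex number $c$ with $|c|=|G|^{-1/2}$. For $h\in G$ let $Z(h)$ be the diagonal unitary on $\mathcal{H}_b$ with $Z(h)|f\rangle=c\,\langle h|F|f\rangle^{-1}|f\rangle$. The input is an arbitrary state $|\Psi\rangle\in\mathcal{H}_A\otimes\mathcal{H}_B$, and $ab$ starts in the entangled state $|G|^{-1/2}\sum_{f\in G}|f\rangle_a\otimes|f\rangle_b$. The steps are, in order: 1. Apply the controlled unitary $\sum_f|f\rangle\langle f|_a\otimes U(f)_A$. 2. Apply $F$ to $a$ and measure $a$ in the standard basis, with outcome $h\in G$, which is sent to $B$'s side. 3. Apply $Z(h)$ to $b$. 4. Apply $M$ to $bB$. 5. Measure $b$ in the standard basis, with outcome $g\in G$, which is sent to $A$'s side. 6. Apply $U(g)^\dagger$ to $A$. The protocol deterministically implements $\mathcal{U}$ if for every pair of measurement outcomes $(h,g)$ the resulting (Kraus) operator acting on $\mathcal{H}_A\otimes\mathcal{H}_B$ is a scalar multiple of $\mathcal{U}$, the scalar being independent of the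 input $|\Psi\rangle$; thus the output is $\mathcal{U}|\Psi\rangle$ (up to phase) with probability 1. *)

theory Defs
  imports "HOL-Analysis.Analysis" "HOL-Algebra.Group"
begin

text \<open>
  Finite-dimensional Hilbert spaces are \<open>complex ^ 'n\<close>, with standard basis indexed by
  the finite type \<open>'n\<close>; operators are matrices, \<open>A $ i $ j\<close> being the element
  \<open>\<langle>i|A|j\<rangle>\<close>. The tensor product of \<open>complex ^ 'm\<close> and \<open>complex ^ 'n\<close>
  is \<open>complex ^ ('m \<times> 'n)\<close>. A finite group is a \<open>group G\<close> with
  \<open>carrier G = UNIV\<close> over a finite type \<open>'g\<close>, so that \<open>complex ^ 'g\<close> has
  an orthonormal basis labelled by the group elements.
\<close>

definition mscale :: "complex \<Rightarrow> complex ^ 'n ^ 'm \<Rightarrow> complex ^ 'n ^ 'm" where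
  "mscale c A = (\<chi> i j. c * A $ i $ j)"

definition adjoint_mat :: "complex ^ 'n ^ 'm \<Rightarrow> complex ^ 'm ^ 'n" where
  "adjoint_mat A = (\<chi> i j. cnj (A $ j $ i))"

definition unitary_mat :: "complex ^ 'n ^ 'n \<Rightarrow> bool" where
  "unitary_mat A \<longleftrightarrow> adjoint_mat A ** A = mat 1 \<and> A ** adjoint_mat A = mat 1"

definition ket :: "'n \<Rightarrow> complex ^ 'n" where
  "ket x = axis x 1"

definition ketbra :: "'m \<Rightarrow> 'n \<Rightarrow> complex ^ 'n ^ 'm" where
  "ketbra x y = (\<chi> i j. if i = x \<and> j = y then 1 else 0)"

definition tensor_vec ::
    "complex ^ 'm \<Rightarrow> complex ^ 'n \<Rightarrow> complex ^ ('m \<times> 'n)" where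
  "tensor_vec v w = (\<chi> p. v $ fst p * w $ snd p)"

definition tensor_mat ::
    "complex ^ 'm ^ 'm \<Rightarrow> complex ^ 'n ^ 'n
      \<Rightarrow> complex ^ ('m \<times> 'n) ^ ('m \<times> 'n)" where
  "tensor_mat A B = (\<chi> p q. A $ fst p $ fst q * B $ snd p $ snd q)"

definition projective_unitary_rep ::
    "'g monoid \<Rightarrow> ('g \<Rightarrow> 'g \<Rightarrow> complex) \<Rightarrow> ('g \<Rightarrow> complex ^ 'n ^ 'n) \<Rightarrow> bool" where
  "projective_unitary_rep G \<mu> U \<longleftrightarrow>
     (\<forall>f\<in>carrier G. unitary_mat (U f)) \<and>
     (\<forall>f\<in>carrier G. \<forall>g\<in>carrier G. cmod (\<mu> f g) = 1) \<and>
     (\<forall>f\<in>carrier G. \<forall>g\<in>carrier G. U f ** U g = mscale (\<mu> f g) (U (f \<otimes>\<^bsub>G\<^esub> g)))"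

definition R_op ::
    "'g::finite monoid \<Rightarrow> ('g \<Rightarrow> 'g \<Rightarrow> complex) \<Rightarrow> 'g \<Rightarrow> complex ^ 'g ^ 'g" where
  "R_op G \<mu> f = (\<Sum>g\<in>carrier G. mscale (\<mu> g f) (ketbra g (g \<otimes>\<^bsub>G\<^esub> f)))"

definition M_op ::
    "'g::finite monoid \<Rightarrow> ('g \<Rightarrow> 'g \<Rightarrow> complex) \<Rightarrow> ('g \<Rightarrow> complex ^ 'b::finite ^ 'b)
      \<Rightarrow> complex ^ ('g \<times> 'b) ^ ('g \<times> 'b)" where
  "M_op G \<mu> W = (\<Sum>f\<in>carrier G. tensor_mat (R_op G \<mu> f) (W f))"

definition target_op ::
    "'g monoid \<Rightarrow> ('g \<Rightarrow> complex ^ 'a ^ 'a) \<Rightarrow> ('g \<Rightarrow> complex ^ 'b ^ 'b)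
      \<Rightarrow> complex ^ ('a::finite \<times> 'b::finite) ^ ('a \<times> 'b)" where
  "target_op G U W = (\<Sum>f\<in>carrier G. tensor_mat (U f) (W f))"


text \<open>
  The four registers are kept in the order \<open>a, b, A, B\<close>, i.e. the joint space is
  \<open>complex ^ ('g \<times> 'g \<times> 'a \<times> 'b)\<close>. The following functions extend an operator
  on some of the registers by the identity on the others.
\<close>

definition on_a ::
    "complex ^ 'g ^ 'g
      \<Rightarrow> complex ^ ('g::finite \<times> 'g \<times> 'a::finite \<times> 'b::finite) ^ ('g \<times> 'g \<times> 'a \<times> 'b)"
  where "on_a X = tensor_mat X (mat 1)"

definition on_b ::
    "complex ^ 'g ^ 'g
      \<Rightarrow> complex ^ ('g::finite \<times> 'g \<times> 'a::finite \<times> 'b::finite) ^ ('g \<times> 'g \<times> 'a \<times> 'b)"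
  where "on_b X = tensor_mat (mat 1) (tensor_mat X (mat 1))"

definition on_A ::
    "complex ^ 'a ^ 'a
      \<Rightarrow> complex ^ ('g::finite \<times> 'g \<times> 'a::finite \<times> 'b::finite) ^ ('g \<times> 'g \<times> 'a \<times> 'b)"
  where "on_A X = tensor_mat (mat 1) (tensor_mat (mat 1) (tensor_mat X (mat 1)))"

definition on_aA ::
    "complex ^ ('g \<times> 'a) ^ ('g \<times> 'a)
      \<Rightarrow> complex ^ ('g::finite \<times> 'g \<times> 'a::finite \<times> 'b::finite) ^ ('g \<times> 'g \<times> 'a \<times> 'b)"
  where "on_aA X = (\<chi> p q. case p of (k, l, i, j) \<Rightarrow> case q of (k', l', i', j') \<Rightarrow>
           if l = l' \<and> j = j' then X $ (k, i) $ (k', i') else 0)"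

definition on_bB ::
    "complex ^ ('g \<times> 'b) ^ ('g \<times> 'b)
      \<Rightarrow> complex ^ ('g::finite \<times> 'g \<times> 'a::finite \<times> 'b::finite) ^ ('g \<times> 'g \<times> 'a \<times> 'b)"
  where "on_bB X = (\<chi> p q. case p of (k, l, i, j) \<Rightarrow> case q of (k', l', i', j') \<Rightarrow>
           if k = k' \<and> i = i' then X $ (l, j) $ (l', j') else 0)"

lemma on_aA_tensor:
  "on_aA (tensor_mat X Y) = tensor_mat X (tensor_mat (mat 1) (tensor_mat Y (mat 1)))"
  by (auto simp: on_aA_def tensor_mat_def mat_def vec_eq_iff)

lemma on_bB_tensor:
  "on_bB (tensor_mat X Y) = tensor_mat (mat 1) (tensor_mat X (tensor_mat (mat 1) Y))"
  by (auto simp: on_bB_def tensor_mat_def mat_def vec_eq_iff)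


definition controlled_op ::
    "'g::finite monoid \<Rightarrow> ('g \<Rightarrow> complex ^ 'a::finite ^ 'a)
      \<Rightarrow> complex ^ ('g \<times> 'a) ^ ('g \<times> 'a)" where
  "controlled_op G U = (\<Sum>f\<in>carrier G. tensor_mat (ketbra f f) (U f))"

definition Z_op :: "complex ^ 'g ^ 'g \<Rightarrow> complex \<Rightarrow> 'g \<Rightarrow> complex ^ 'g ^ 'g" where
  "Z_op F c h = (\<chi> i j. if i = j then c * inverse (F $ h $ i) else 0)"

definition initial_state ::
    "'g::finite monoid \<Rightarrow> complex ^ ('a::finite \<times> 'b::finite)
      \<Rightarrow> complex ^ ('g \<times> 'g \<times> 'a \<times> 'b)" where
  "initial_state G \<Psi> = complex_of_real (1 / sqrt (card (carrier G))) *s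
     (\<Sum>f\<in>carrier G. tensor_vec (ket f) (tensor_vec (ket f) \<Psi>))"

text \<open>
  The joint state after the whole protocol on the branch with outcomes \<open>(h, g)\<close>, read
  from right to left (bottom to top). A measurement with a given outcome acts as the projector
  onto the corresponding basis vector, without renormalisation, so that the squared norm of the
  final vector is the probability of the branch.
\<close>

definition final_state ::
    "'g::finite monoid \<Rightarrow> ('g \<Rightarrow> complex ^ 'a::finite ^ 'a)
      \<Rightarrow> complex ^ ('g \<times> 'b::finite) ^ ('g \<times> 'b) \<Rightarrow> complex ^ 'g ^ 'g \<Rightarrow> complex
      \<Rightarrow> 'g \<Rightarrow> 'g \<Rightarrow> complex ^ ('a \<times> 'b) \<Rightarrow> complex ^ ('g \<times> 'g \<times> 'a \<times> 'b)" where
  "final_state G U M F c h g \<Psi> =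
     on_A (adjoint_mat (U g)) *v
     (on_b (ketbra g g) *v
     (on_bB M *v
     (on_b (Z_op F c h) *v
     (on_a (ketbra h h) *v
     (on_a F *v
     (on_aA (controlled_op G U) *v
     initial_state G \<Psi>))))))"

text \<open>
  The first conjunct says that the Kraus operator of every branch is a scalar multiple of
  \<open>V\<close>: the ancillas are left in \<open>|h\<rangle>|g\<rangle>\<close>, and \<open>AB\<close> in
  \<open>s V \<Psi>\<close> with \<open>s\<close> independent of \<open>\<Psi>\<close>. The second says that, for a
  normalised input, the branches whose normalised output is \<open>V \<Psi>\<close> up to a phase have
  total probability 1.
\<close>

definition deterministically_implements ::
    "'g::finite monoid \<Rightarrow> ('g \<Rightarrow> complex ^ 'a::finite ^ 'a)
      \<Rightarrow> complex ^ ('g \<times> 'b::finite) ^ ('g \<times> 'b) \<Rightarrow> complex ^ 'g ^ 'g \<Rightarrow> complex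
      \<Rightarrow> complex ^ ('a \<times> 'b) ^ ('a \<times> 'b) \<Rightarrow> bool" where
  "deterministically_implements G U M F c V \<longleftrightarrow>
     (\<forall>h\<in>carrier G. \<forall>g\<in>carrier G. \<exists>s. \<forall>\<Psi>.
        final_state G U M F c h g \<Psi> = tensor_vec (ket h) (tensor_vec (ket g) (s *s (V *v \<Psi>)))) \<and>
     (\<forall>\<Psi>. norm \<Psi> = 1 \<longrightarrow>
        (\<Sum>(h, g) \<in> {(h, g) \<in> carrier G \<times> carrier G. \<exists>\<phi>. cmod \<phi> = 1 \<and>
             sgn (final_state G U M F c h g \<Psi>) =
               tensor_vec (ket h) (tensor_vec (ket g) (\<phi> *s (V *v \<Psi>)))}.
           (norm (final_state G U M F c h g \<Psi>))\<^sup>2) = 1)"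

end

theory Submission
  imports Defs
begin

text \<open>
  The block \<open>\<langle>g|M|gf\<rangle>\<close> equals \<open>\<mu>(g, f) W(f)\<close>, and \<open>\<mu>(g, f) U(gf) = U(g) U(f)\<close>. Hence
  \<open>M\<close> maps \<open>\<Sum>\<^sub>l |l\<rangle> \<otimes> U(l)\<Psi>\<close> to \<open>\<Sum>\<^sub>g |g\<rangle> \<otimes> U(g) \<U>\<Psi>\<close>. The
  first of these vectors is, up to a scalar, the state before \<open>M\<close> is applied, because \<open>Z(h)\<close>
  cancels the matrix elements of \<open>F\<close>; the correction \<open>U(g)\<^sup>\<dagger>\<close> then leaves
  \<open>\<U>\<Psi>\<close> on every branch, with the same weight \<open>1 / |G|\<^sup>2\<close>. The same identity
  yields the unitarity of \<open>\<U>\<close>: comparing inner products of both sides, all \<open>U(g)\<close> and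
  \<open>M\<close> being isometries, gives \<open>|G| \<langle>\<U>\<Phi>, \<U>\<Psi>\<rangle> = |G| \<langle>\<Phi>, \<Psi>\<rangle>\<close>.
\<close>

section \<open>Hermitian inner product and unitary matrices\<close>

text \<open>The type-class inner product on \<open>complex ^ 'n\<close> is only the real part of
  this form. The complex form is conjugate-linear on the left and lets a coordinate be read off by
  pairing with a basis vector.\<close>

definition cinner :: "complex ^ 'n \<Rightarrow> complex ^ 'n \<Rightarrow> complex" where
  "cinner x y = (\<Sum>i\<in>UNIV. cnj (x $ i) * y $ i)"

lemma cinner_self: "cinner x x = complex_of_real ((norm x)\<^sup>2)"
proof -
  have "(norm x)\<^sup>2 = (\<Sum>i\<in>UNIV. (cmod (x $ i))\<^sup>2)"
    by (simp add: norm_vec_def L2_set_def sum_nonneg)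
  then show ?thesis
    by (simp add: cinner_def complex_norm_square mult.commute del: of_real_power)
qed

lemma cinner_matrix_vector_mult:
  fixes A :: "complex ^ 'n ^ 'n"
  shows "cinner (A *v x) (A *v y) = cinner x ((adjoint_mat A ** A) *v y)"
proof -
  have "cinner (A *v x) (A *v y) =
      (\<Sum>k\<in>UNIV. \<Sum>i\<in>UNIV. cnj (A $ k $ i) * cnj (x $ i) * (A *v y) $ k)"
    by (simp add: cinner_def matrix_vector_mult_def sum_distrib_right)
  also have "\<dots> = (\<Sum>i\<in>UNIV. \<Sum>k\<in>UNIV. cnj (A $ k $ i) * cnj (x $ i) * (A *v y) $ k)"
    by (rule sum.swap)
  also have "\<dots> = cinner x (adjoint_mat A *v (A *v y))"
    unfolding cinner_def matrix_vector_mult_def [of "adjoint_mat A"]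
    by (simp add: adjoint_mat_def sum_distrib_left mult_ac)
  finally show ?thesis
    by (simp add: matrix_vector_mul_assoc)
qed

lemma unitary_mat_cinner:
  assumes "unitary_mat A"
  shows "cinner (A *v x) (A *v y) = cinner x y"
  using assms by (simp add: cinner_matrix_vector_mult unitary_mat_def)

lemma cinner_axis_left: "cinner (axis i 1) y = y $ i"
  by (simp add: cinner_def axis_def if_distrib if_distribR cong: if_cong)

text \<open>Pairing with basis vectors identifies \<open>adjoint_mat A ** A\<close> with the
  identity. The other half of unitarity follows because a left inverse of a square matrix is a right
  inverse.\<close>

lemma unitary_matI:
  assumes "\<And>x y. cinner (A *v x) (A *v y) = cinner x y"
  shows "unitary_mat A"
proof -
  have "(adjoint_mat A ** A) *v y = mat 1 *v y" for y
  proof (rule vec_eq_iff [THEN iffD2], rule allI)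
    fix i
    show "((adjoint_mat A ** A) *v y) $ i = (mat 1 *v y) $ i"
      using assms [of "axis i 1" y]
      by (simp only: cinner_matrix_vector_mult cinner_axis_left matrix_vector_mul_lid)
  qed
  then have "adjoint_mat A ** A = mat 1"
    by (simp add: matrix_eq)
  then show ?thesis
    by (simp add: unitary_mat_def matrix_left_right_inverse)
qed

lemma unitary_mat_norm:
  assumes "unitary_mat A"
  shows "norm (A *v x) = norm x"
proof -
  have "complex_of_real ((norm (A *v x))\<^sup>2) = complex_of_real ((norm x)\<^sup>2)"
    by (simp only: cinner_self [symmetric] unitary_mat_cinner [OF assms])
  then have "(norm (A *v x))\<^sup>2 = (norm x)\<^sup>2"
    by (simp only: of_real_eq_iff)
  then show ?thesis
    by simp
qed

section \<open>Operators on tensor products\<close>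

lemma sum_UNIV_prod: "(\<Sum>p\<in>UNIV. f p) = (\<Sum>x\<in>UNIV. \<Sum>y\<in>UNIV. f (x, y))"
  by (simp add: sum.cartesian_product)

lemma sum_if_const: "(\<Sum>x\<in>S. if P then f x else 0) = (if P then sum f S else 0)"
  by simp

lemma sum_matrix_vector_mult:
  fixes A :: "'i \<Rightarrow> complex ^ 'n ^ 'm"
  shows "(\<Sum>f\<in>S. A f) *v x = (\<Sum>f\<in>S. A f *v x)"
  by (induction S rule: infinite_finite_induct) (simp_all add: matrix_vector_mult_add_rdistrib)

lemma tensor_mat_mult_vec_nth:
  "(tensor_mat A B *v x) $ (i, j) =
     (\<Sum>i'\<in>UNIV. \<Sum>j'\<in>UNIV. A $ i $ i' * B $ j $ j' * x $ (i', j'))"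
  by (simp add: matrix_vector_mult_def tensor_mat_def sum_UNIV_prod)

lemma tensor_mat_id_mult_vec_nth:
  "(tensor_mat A (mat 1) *v x) $ (i, j) = (\<Sum>i'\<in>UNIV. A $ i $ i' * x $ (i', j))"
proof -
  have "(tensor_mat A (mat 1) *v x) $ (i, j) =
      (\<Sum>i'\<in>UNIV. \<Sum>j'\<in>UNIV. if j = j' then A $ i $ i' * x $ (i', j') else 0)"
    unfolding tensor_mat_mult_vec_nth by (intro sum.cong refl) (simp add: mat_def)
  then show ?thesis
    by simp
qed

lemma id_tensor_mat_mult_vec_nth:
  "(tensor_mat (mat 1) B *v x) $ (i, j) = (B *v (\<chi> j'. x $ (i, j'))) $ j"
proof -
  have "(tensor_mat (mat 1) B *v x) $ (i, j) =
      (\<Sum>i'\<in>UNIV. if i = i' then \<Sum>j'\<in>UNIV. B $ j $ j' * x $ (i', j') else 0)"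
    unfolding tensor_mat_mult_vec_nth by (intro sum.cong refl) (simp add: mat_def)
  then show ?thesis
    by (simp add: matrix_vector_mult_def)
qed

lemma tensor_mat_mult: "tensor_mat A B ** tensor_mat C D = tensor_mat (A ** C) (B ** D)"
  by (simp add: vec_eq_iff matrix_matrix_mult_def tensor_mat_def sum_UNIV_prod sum_product mult_ac)

lemma tensor_mat_id: "tensor_mat (mat 1) (mat 1) = mat 1"
  by (auto simp: vec_eq_iff tensor_mat_def mat_def)

lemma adjoint_mat_tensor_mat:
  "adjoint_mat (tensor_mat A B) = tensor_mat (adjoint_mat A) (adjoint_mat B)"
  by (simp add: vec_eq_iff tensor_mat_def adjoint_mat_def)

lemma adjoint_mat_id: "adjoint_mat (mat 1) = mat 1"
  by (auto simp: vec_eq_iff adjoint_mat_def mat_def)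

lemma unitary_mat_tensor_id:
  assumes "unitary_mat A"
  shows "unitary_mat (tensor_mat A (mat 1))"
  using assms
  by (simp add: unitary_mat_def adjoint_mat_tensor_mat adjoint_mat_id tensor_mat_mult tensor_mat_id)

lemma norm_tensor_vec: "norm (tensor_vec v w) = norm v * norm w"
  by (simp add: norm_vec_def L2_set_def tensor_vec_def sum_UNIV_prod norm_mult power_mult_distrib
      sum_product [symmetric] real_sqrt_mult)

lemma norm_ket: "norm (ket x) = 1"
proof -
  have "(\<Sum>i\<in>UNIV. (cmod (ket x $ i))\<^sup>2) = (\<Sum>i\<in>UNIV. if i = x then 1 else 0)"
    by (intro sum.cong refl) (auto simp: ket_def axis_def)
  then show ?thesis
    by (simp add: norm_vec_def L2_set_def)
qed

lemma norm_complex_scale: "norm (s *s (x :: complex ^ 'n)) = cmod s * norm x"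
  by (simp add: norm_vec_def norm_mult L2_set_right_distrib)

section \<open>Operators on the four registers\<close>

lemma on_a_nth: "(on_a X *v v) $ (k, l, i, j) = (\<Sum>k'\<in>UNIV. X $ k $ k' * v $ (k', l, i, j))"
  by (simp add: on_a_def tensor_mat_id_mult_vec_nth)

lemma on_b_nth: "(on_b X *v v) $ (k, l, i, j) = (\<Sum>l'\<in>UNIV. X $ l $ l' * v $ (k, l', i, j))"
  by (simp only: on_b_def id_tensor_mat_mult_vec_nth tensor_mat_id_mult_vec_nth vec_lambda_beta)

lemma on_A_nth: "(on_A X *v v) $ (k, l, i, j) = (\<Sum>i'\<in>UNIV. X $ i $ i' * v $ (k, l, i', j))"
  by (simp only: on_A_def id_tensor_mat_mult_vec_nth tensor_mat_id_mult_vec_nth vec_lambda_beta)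

lemma on_aA_nth:
  "(on_aA X *v v) $ (k, l, i, j) =
     (\<Sum>k'\<in>UNIV. \<Sum>i'\<in>UNIV. X $ (k, i) $ (k', i') * v $ (k', l, i', j))"
proof -
  have "(on_aA X *v v) $ (k, l, i, j) =
      (\<Sum>k'\<in>UNIV. \<Sum>l'\<in>UNIV. \<Sum>i'\<in>UNIV. \<Sum>j'\<in>UNIV. if j = j' then
         if l = l' then X $ (k, i) $ (k', i') * v $ (k', l', i', j') else 0 else 0)"
    unfolding on_aA_def matrix_vector_mult_def sum_UNIV_prod vec_lambda_beta
    by (intro sum.cong refl) auto
  then show ?thesis
    by (simp add: sum_if_const)
qed

lemma on_bB_nth:
  "(on_bB X *v v) $ (k, l, i, j) =
     (\<Sum>l'\<in>UNIV. \<Sum>j'\<in>UNIV. X $ (l, j) $ (l', j') * v $ (k, l', i, j'))"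
proof -
  have "(on_bB X *v v) $ (k, l, i, j) =
      (\<Sum>k'\<in>UNIV. \<Sum>l'\<in>UNIV. \<Sum>i'\<in>UNIV. \<Sum>j'\<in>UNIV. if i = i' then
         if k = k' then X $ (l, j) $ (l', j') * v $ (k', l', i', j') else 0 else 0)"
    unfolding on_bB_def matrix_vector_mult_def sum_UNIV_prod vec_lambda_beta
    by (intro sum.cong refl) auto
  then show ?thesis
    by (simp add: sum_if_const)
qed

lemma on_a_ketbra_nth:
  "(on_a (ketbra h h) *v v) $ (k, l, i, j) = (if k = h then v $ (h, l, i, j) else 0)"
proof -
  have "(on_a (ketbra h h) *v v) $ (k, l, i, j) =
      (\<Sum>k'\<in>UNIV. if k' = h then if k = h then v $ (k', l, i, j) else 0 else 0)"
    unfolding on_a_nth by (intro sum.cong refl) (simp add: ketbra_def)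
  then show ?thesis
    by simp
qed

lemma on_b_ketbra_nth:
  "(on_b (ketbra g g) *v v) $ (k, l, i, j) = (if l = g then v $ (k, g, i, j) else 0)"
proof -
  have "(on_b (ketbra g g) *v v) $ (k, l, i, j) =
      (\<Sum>l'\<in>UNIV. if l' = g then if l = g then v $ (k, l', i, j) else 0 else 0)"
    unfolding on_b_nth by (intro sum.cong refl) (simp add: ketbra_def)
  then show ?thesis
    by simp
qed

lemma on_b_Z_op_nth:
  "(on_b (Z_op F c h) *v v) $ (k, l, i, j) = c * inverse (F $ h $ l) * v $ (k, l, i, j)"
proof -
  have "(on_b (Z_op F c h) *v v) $ (k, l, i, j) =
      (\<Sum>l'\<in>UNIV. if l' = l then c * inverse (F $ h $ l) * v $ (k, l', i, j) else 0)"
    unfolding on_b_nth by (intro sum.cong refl) (auto simp: Z_op_def)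
  then show ?thesis
    by simp
qed

lemma initial_state_nth:
  assumes "carrier G = UNIV"
  shows "initial_state G \<Psi> $ (k, l, i, j) =
    (if k = l then complex_of_real (1 / sqrt (card (carrier G))) * \<Psi> $ (i, j) else 0)"
proof -
  have "(\<Sum>f\<in>UNIV. tensor_vec (ket f) (tensor_vec (ket f) \<Psi>)) $ (k, l, i, j) =
      (\<Sum>f\<in>UNIV. if f = k then if f = l then \<Psi> $ (i, j) else 0 else 0)"
    unfolding sum_component by (intro sum.cong refl) (auto simp: tensor_vec_def ket_def axis_def)
  then show ?thesis
    by (simp add: initial_state_def assms)
qed

lemma controlled_op_nth:
  assumes "carrier G = UNIV"
  shows "controlled_op G U $ (k, i) $ (k', i') = (if k' = k then U k $ i $ i' else 0)"
proof -
  have "controlled_op G U $ (k, i) $ (k', i') =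
      (\<Sum>f\<in>UNIV. if f = k then if k' = f then U f $ i $ i' else 0 else 0)"
    unfolding controlled_op_def assms sum_component
    by (intro sum.cong refl) (auto simp: tensor_mat_def ketbra_def)
  then show ?thesis
    by simp
qed

section \<open>The group protocol\<close>

text \<open>The condition l = gf is not solved for f, because the later sum over l collapses it
  directly.\<close>

lemma M_op_nth:
  assumes "carrier G = UNIV"
  shows "M_op G \<mu> W $ (g, j) $ (l, j') =
    (\<Sum>f\<in>UNIV. if l = g \<otimes>\<^bsub>G\<^esub> f then \<mu> g f * W f $ j $ j' else 0)"
proof -
  have "R_op G \<mu> f $ g $ l = (if l = g \<otimes>\<^bsub>G\<^esub> f then \<mu> g f else 0)" for f
  proof -
    have "R_op G \<mu> f $ g $ l =
        (\<Sum>g'\<in>UNIV. if g' = g then if l = g' \<otimes>\<^bsub>G\<^esub> f then \<mu> g' f else 0 else 0)"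
      unfolding R_op_def assms sum_component
      by (intro sum.cong refl) (auto simp: mscale_def ketbra_def)
    then show ?thesis
      by simp
  qed
  then show ?thesis
    unfolding M_op_def assms sum_component by (intro sum.cong refl) (auto simp: tensor_mat_def)
qed

text \<open>Coordinate form of the identity on which both halves of the theorem rest. The A-index i
  is a spectator: \<open>M_op\<close> acts on bB only, so each i can be treated separately.\<close>

lemma M_op_intertwines:
  assumes "carrier G = UNIV" and "projective_unitary_rep G \<mu> U"
  shows "(\<Sum>l\<in>UNIV. \<Sum>j'\<in>UNIV. M_op G \<mu> W $ (g, j) $ (l, j') *
             (tensor_mat (U l) (mat 1) *v \<Psi>) $ (i, j')) =
         (tensor_mat (U g) (mat 1) *v (target_op G U W *v \<Psi>)) $ (i, j)"
proof -
  let ?x = "\<lambda>l j'. (tensor_mat (U l) (mat 1) *v \<Psi>) $ (i, j')"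
  have rep: "(U g ** U f) $ i $ i' = \<mu> g f * U (g \<otimes>\<^bsub>G\<^esub> f) $ i $ i'" for f i'
    using assms by (simp add: projective_unitary_rep_def mscale_def)
  have "(\<Sum>l\<in>UNIV. \<Sum>j'\<in>UNIV. M_op G \<mu> W $ (g, j) $ (l, j') * ?x l j') =
      (\<Sum>l\<in>UNIV. \<Sum>j'\<in>UNIV. \<Sum>f\<in>UNIV.
         if l = g \<otimes>\<^bsub>G\<^esub> f then \<mu> g f * W f $ j $ j' * ?x l j' else 0)"
    by (simp add: M_op_nth [OF assms(1)] sum_distrib_right if_distrib if_distribR cong: if_cong)
  \<comment> \<open>Once the sum over l is innermost, l = gf selects exactly one term for each
    f.\<close>
  also have "\<dots> = (\<Sum>j'\<in>UNIV. \<Sum>f\<in>UNIV. \<Sum>l\<in>UNIV.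
         if l = g \<otimes>\<^bsub>G\<^esub> f then \<mu> g f * W f $ j $ j' * ?x l j' else 0)"
    by (rule trans [OF sum.swap], rule sum.cong [OF refl], rule sum.swap)
  also have "\<dots> = (\<Sum>j'\<in>UNIV. \<Sum>f\<in>UNIV. \<mu> g f * W f $ j $ j' * ?x (g \<otimes>\<^bsub>G\<^esub> f) j')"
    by simp
  also have "\<dots> = (\<Sum>f\<in>UNIV. \<Sum>j'\<in>UNIV. \<mu> g f * W f $ j $ j' * ?x (g \<otimes>\<^bsub>G\<^esub> f) j')"
    by (rule sum.swap)
  \<comment> \<open>The factor \<open>\<mu> g f\<close> is absorbed by turning U(gf) into the
    product of U(g) and U(f).\<close>
  also have "\<dots> = (\<Sum>f\<in>UNIV. (tensor_mat (U g ** U f) (W f) *v \<Psi>) $ (i, j))"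
  proof (rule sum.cong [OF refl])
    fix f
    have "(\<Sum>j'\<in>UNIV. \<mu> g f * W f $ j $ j' * ?x (g \<otimes>\<^bsub>G\<^esub> f) j') =
        (\<Sum>j'\<in>UNIV. \<Sum>i'\<in>UNIV. (U g ** U f) $ i $ i' * W f $ j $ j' * \<Psi> $ (i', j'))"
      by (simp add: tensor_mat_id_mult_vec_nth rep sum_distrib_left mult_ac)
    also have "\<dots> = (tensor_mat (U g ** U f) (W f) *v \<Psi>) $ (i, j)"
      by (subst sum.swap) (simp add: tensor_mat_mult_vec_nth)
    finally show "(\<Sum>j'\<in>UNIV. \<mu> g f * W f $ j $ j' * ?x (g \<otimes>\<^bsub>G\<^esub> f) j') =
        (tensor_mat (U g ** U f) (W f) *v \<Psi>) $ (i, j)" .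
  qed
  \<comment> \<open>The factor U(g) does not depend on f, so it leaves the sum by linearity, and
    what remains is \<open>target_op\<close>.\<close>
  also have "\<dots> = (tensor_mat (U g) (mat 1) *v (target_op G U W *v \<Psi>)) $ (i, j)"
    by (simp add: target_op_def assms(1) sum_matrix_vector_mult linear_sum
        [OF matrix_vector_mul_linear] matrix_vector_mul_assoc tensor_mat_mult)
  finally show ?thesis .
qed

lemma unitary_target_op:
  fixes G :: "'g::finite monoid"
    and U :: "'g \<Rightarrow> complex ^ 'a::finite ^ 'a"
    and W :: "'g \<Rightarrow> complex ^ 'b::finite ^ 'b"
  assumes "carrier G = UNIV" and "projective_unitary_rep G \<mu> U"
    and "unitary_mat (M_op G \<mu> W)"
  shows "unitary_mat (target_op G U W)"
proof (rule unitary_matI)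
  let ?T = "target_op G U W"
  let ?U = "\<lambda>g. tensor_mat (U g) (mat 1)"
  have U: "unitary_mat (?U g)" for g
    using assms(1,2) by (simp add: projective_unitary_rep_def unitary_mat_tensor_id)
  \<comment> \<open>\<open>x \<Psi> i\<close> is the slice at A-index i of the sum of |g> tensor
    (U(g) tensor 1)\<Psi> over all g. Slicing leaves a vector on bB, on which \<open>M_op\<close>
    acts as a plain matrix.\<close>
  define x :: "complex ^ ('a \<times> 'b) \<Rightarrow> 'a \<Rightarrow> complex ^ ('g \<times> 'b)" where "x = (\<lambda>\<Psi> i. \<chi> p. (?U (fst p) *v \<Psi>) $ (i, snd p))"
  \<comment> \<open>Adding the slices restores the inner product of the full vectors, to which each
    group element contributes \<open>cinner \<Phi> \<Psi>\<close>.\<close>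
  have cinner_x: "(\<Sum>i\<in>UNIV. cinner (x \<Phi> i) (x \<Psi> i)) = of_nat CARD('g) * cinner \<Phi> \<Psi>" for \<Phi> \<Psi>
  proof -
    have "(\<Sum>i\<in>UNIV. cinner (x \<Phi> i) (x \<Psi> i)) =
        (\<Sum>g\<in>UNIV. cinner (?U g *v \<Phi>) (?U g *v \<Psi>))"
      by (simp add: cinner_def x_def sum_UNIV_prod) (rule sum.swap)
    then show ?thesis
      by (simp add: unitary_mat_cinner [OF U])
  qed
  have Mx: "M_op G \<mu> W *v x \<Psi> i = x (?T *v \<Psi>) i" for \<Psi> i
    by (simp add: vec_eq_iff matrix_vector_mult_def [of "M_op G \<mu> W"] sum_UNIV_prod x_def
        M_op_intertwines [OF assms(1,2)])
  fix \<Phi> \<Psi>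
  have "of_nat CARD('g) * cinner (?T *v \<Phi>) (?T *v \<Psi>) =
      (\<Sum>i\<in>UNIV. cinner (M_op G \<mu> W *v x \<Phi> i) (M_op G \<mu> W *v x \<Psi> i))"
    by (simp add: Mx cinner_x)
  also have "\<dots> = of_nat CARD('g) * cinner \<Phi> \<Psi>"
    by (simp add: unitary_mat_cinner [OF assms(3)] cinner_x)
  finally show "cinner (?T *v \<Phi>) (?T *v \<Psi>) = cinner \<Phi> \<Psi>"
    by simp
qed

text \<open>The scalar collects the normalisation of the entangled state and the constant c of Z(h).
  The entry of F produced by the first measurement cancels against Z(h), so the scalar depends on
  neither outcome.\<close>

lemma final_state_eq:
  fixes G :: "'g::finite monoid"
    and U :: "'g \<Rightarrow> complex ^ 'a::finite ^ 'a"
    and W :: "'g \<Rightarrow> complex ^ 'b::finite ^ 'b"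
  assumes "carrier G = UNIV" and "projective_unitary_rep G \<mu> U" and "\<And>f. F $ h $ f \<noteq> 0"
  shows "final_state G U (M_op G \<mu> W) F c h g \<Psi> =
    tensor_vec (ket h) (tensor_vec (ket g)
      ((complex_of_real (1 / sqrt (card (carrier G))) * c) *s (target_op G U W *v \<Psi>)))"
proof -
  let ?U = "\<lambda>g. tensor_mat (U g) (mat 1)"
  let ?n = "complex_of_real (1 / sqrt (card (carrier G)))"
  let ?y = "target_op G U W *v \<Psi>"
  \<comment> \<open>The stages are the state after the controlled unitary (\<open>v1\<close>), after
    Z(h) (\<open>v2\<close>) and after the second measurement (\<open>v3\<close>).\<close>
  define v1 where "v1 = on_aA (controlled_op G U) *v initial_state G \<Psi>"
  define v2 where "v2 = on_b (Z_op F c h) *v (on_a (ketbra h h) *v (on_a F *v v1))"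
  define v3 where "v3 = on_b (ketbra g g) *v (on_bB (M_op G \<mu> W) *v v2)"
  \<comment> \<open>Registers a and b carry the same label, so the control can be read from b, and
    U(l) survives the measurement of a.\<close>
  have v1: "v1 $ (k, l, i, j) = (if k = l then ?n * (?U l *v \<Psi>) $ (i, j) else 0)" for k l i j
  proof -
    have "v1 $ (k, l, i, j) = (\<Sum>k'\<in>UNIV. if k' = k then
        \<Sum>i'\<in>UNIV. U k $ i $ i' * (if k' = l then ?n * \<Psi> $ (i', j) else 0) else 0)"
      unfolding v1_def on_aA_nth controlled_op_nth [OF assms(1)] initial_state_nth [OF assms(1)]
      by (rule sum.cong [OF refl]) auto
    then show ?thesis
      by (simp add: tensor_mat_id_mult_vec_nth sum_distrib_left mult_ac)
  qed
  have v2: "v2 $ (k, l, i, j) = (if k = h then ?n * c * (?U l *v \<Psi>) $ (i, j) else 0)" for k l i j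
  proof -
    \<comment> \<open>Only k' = l contributes, so a single entry of F appears instead of a
      sum.\<close>
    have F: "(on_a F *v v1) $ (h, l, i, j) = F $ h $ l * (?n * (?U l *v \<Psi>) $ (i, j))"
      by (simp add: on_a_nth v1 if_distrib cong: if_cong)
    show ?thesis
      \<comment> \<open>The cancellation needs a nonzero entry, since
        \<open>inverse 0 = 0\<close>.\<close>
      using assms(3) [of l] by (simp add: v2_def on_b_Z_op_nth on_a_ketbra_nth F)
  qed
  have v3: "v3 $ (k, l, i, j) =
      (if k = h \<and> l = g then ?n * c * (?U g *v ?y) $ (i, j) else 0)" for k l i j
  proof -
    have M: "(on_bB (M_op G \<mu> W) *v v2) $ (k, l, i, j) =
        (if k = h then ?n * c * (\<Sum>l'\<in>UNIV. \<Sum>j'\<in>UNIV. M_op G \<mu> W $ (l, j) $ (l', j') *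
           (?U l' *v \<Psi>) $ (i, j')) else 0)" for l
      by (simp add: on_bB_nth v2 sum_distrib_left mult_ac)
    show ?thesis
      unfolding v3_def on_b_ketbra_nth M M_op_intertwines [OF assms(1,2)] by simp
  qed
  have U: "tensor_mat (adjoint_mat (U g)) (mat 1) *v (?U g *v y) = y" for y
    using assms(1,2)
    by (simp add: projective_unitary_rep_def unitary_mat_def matrix_vector_mul_assoc
        tensor_mat_mult tensor_mat_id)
  have "(on_A (adjoint_mat (U g)) *v v3) $ (k, l, i, j) =
      (if k = h \<and> l = g then ?n * c * ?y $ (i, j) else 0)" for k l i j
  proof -
    have "(on_A (adjoint_mat (U g)) *v v3) $ (k, l, i, j) = (if k = h \<and> l = g then
        ?n * c * (tensor_mat (adjoint_mat (U g)) (mat 1) *v (?U g *v ?y)) $ (i, j) else 0)"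
      unfolding tensor_mat_id_mult_vec_nth [of "adjoint_mat (U g)"]
      by (cases "k = h"; cases "l = g") (simp_all add: on_A_nth v3 sum_distrib_left mult_ac)
    then show ?thesis
      unfolding U .
  qed
  then show ?thesis
    by (auto simp: final_state_def v3_def v2_def v1_def vec_eq_iff tensor_vec_def ket_def axis_def)
qed

theorem theorem3:
  fixes G :: "'g::finite monoid"
    and \<mu> :: "'g \<Rightarrow> 'g \<Rightarrow> complex"
    and U :: "'g \<Rightarrow> complex ^ 'a::finite ^ 'a"
    and W :: "'g \<Rightarrow> complex ^ 'b::finite ^ 'b"
    and F :: "complex ^ 'g ^ 'g"
    and c :: complex
  assumes "group G" and "carrier G = UNIV"
    and "projective_unitary_rep G \<mu> U"
    and "U \<one>\<^bsub>G\<^esub> = mat 1"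
    and "unitary_mat (M_op G \<mu> W)"
    and "unitary_mat F"
    and "\<And>h f. h \<in> carrier G \<Longrightarrow> f \<in> carrier G \<Longrightarrow>
           cmod (F $ h $ f) = 1 / sqrt (card (carrier G))"
    and "cmod c = 1 / sqrt (card (carrier G))"
  shows "unitary_mat (target_op G U W) \<and>
         deterministically_implements G U (M_op G \<mu> W) F c (target_op G U W)"
proof
  let ?T = "target_op G U W"
  let ?N = "real (card (carrier G))"
  let ?s = "complex_of_real (1 / sqrt ?N) * c"
  let ?fin = "final_state G U (M_op G \<mu> W) F c"
  have N: "?N > 0"
    by (simp add: assms(2))
  show T: "unitary_mat ?T"
    using assms(2,3,5) by (rule unitary_target_op)
  have "F $ h $ f \<noteq> 0" for h f
    using assms(7) [of h f] N by (auto simp: assms(2))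
  then have fin: "?fin h g \<Psi> = tensor_vec (ket h) (tensor_vec (ket g) (?s *s (?T *v \<Psi>)))" for h g \<Psi>
    using final_state_eq [OF assms(2,3)] by blast
  have s: "cmod ?s = 1 / ?N"
    by (simp add: norm_mult norm_divide assms(8))
  show "deterministically_implements G U (M_op G \<mu> W) F c ?T"
    unfolding deterministically_implements_def
  proof (intro conjI ballI allI impI)
    fix h g
    show "\<exists>s. \<forall>\<Psi>. ?fin h g \<Psi> = tensor_vec (ket h) (tensor_vec (ket g) (s *s (?T *v \<Psi>)))"
      using fin by blast
  next
    fix \<Psi> :: "complex ^ ('a \<times> 'b)"
    assume "norm \<Psi> = 1"
    \<comment> \<open>All branches are equally likely, each with probability 1/N^2 for N =
      |G|.\<close>
    then have norm_fin: "norm (?fin h g \<Psi>) = 1 / ?N" for h g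
      by (simp only: fin norm_tensor_vec norm_ket norm_complex_scale s unitary_mat_norm [OF T])
    have sgn_fin: "sgn (?fin h g \<Psi>) =
        tensor_vec (ket h) (tensor_vec (ket g) ((of_real ?N * ?s) *s (?T *v \<Psi>)))" for h g
      unfolding sgn_div_norm norm_fin
      by (simp add: fin vec_eq_iff tensor_vec_def scaleR_conv_of_real [where 'a = complex] mult_ac)
    \<comment> \<open>Normalising a branch multiplies its scalar by N, which gives the phase witness
      \<open>of_real ?N * ?s\<close>.\<close>
    have "cmod (of_real ?N * ?s) = 1"
      unfolding norm_mult [of "of_real ?N"] s using N by auto
    then have "{(h, g) \<in> carrier G \<times> carrier G. \<exists>\<phi>. cmod \<phi> = 1 \<and>
        sgn (?fin h g \<Psi>) = tensor_vec (ket h) (tensor_vec (ket g) (\<phi> *s (?T *v \<Psi>)))}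
        = carrier G \<times> carrier G"
      unfolding sgn_fin by blast
    \<comment> \<open>Every pair of outcomes qualifies, so the total is N^2 terms of size
      1/N^2.\<close>
    then show "(\<Sum>(h, g) \<in> {(h, g) \<in> carrier G \<times> carrier G. \<exists>\<phi>. cmod \<phi> = 1 \<and>
        sgn (?fin h g \<Psi>) = tensor_vec (ket h) (tensor_vec (ket g) (\<phi> *s (?T *v \<Psi>)))}.
        (norm (?fin h g \<Psi>))\<^sup>2) = 1"
      using N by (auto simp: norm_fin assms(2) card_cartesian_product power2_eq_square)
  qed
qed

end
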